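(* Let $\mathcal{H}_1$ and $\mathcal{H}_2$ be two $n$-qubit Hamiltonians, each written as a finite sum $\sum_r c_r p_r$ with pairwise distinct Pauli strings $p_r\in\{I,X,Y,Z\}^{\otimes n}$ and coefficients $c_r\in\mathbb{C}\setminus\{0\}$, and let $\mathcal{G}_1,\mathcal{G}_2$ be the coloured bipartite graphs constructed from $\mathcal{H}_1,\mathcal{H}_2$ respectively. Then $\mathcal{H}_1$ and $\mathcal{H}_2$ are permutation equivalent if and only if $\mathcal{G}_1$ and $\mathcal{G}_2$ are isomorphic as coloured graphs: $$\mathcal{H}_1\sim_P\mathcal{H}_2\iff \mathcal{G}_1\cong\mathcal{G}_2.$$
   Context: Pauli strings and permutations: a Pauli string on $n$ qubits is a tensor product $p=\bigotimes_{i=1}^n [p]_i$ with $[p]_i\in\{I,X,Y,Z\}$ (the identity and the three Pauli matrices); $[p]_i$ is the operator of $p$ at qubit $i$. A permutation $\varsigma\in S_n$ acts on Pauli strings by moving the operator at qubit $i$ to qubit $\varsigma(i)$, i.e. $[\varsigma(p)]_{\varsigma(i)}=[p]_i$ for all $i$. A Hamiltonian $\mathcal{H}=\sum_{r=1}^m c_rp_r$ is represented by the finite set $T=\{(c_r,p_r): r=1,\dots,m\}$, with at most one pair $(c,p)$ for each Pauli string $p$. For $\varsigma\in S_n$ one sets $\varsigma(T)=\{(c_r,\varsigma(p_r)) : r=1,\dots,m\}$. Permutation equivalence: if $T_1,T_2$ are the sets representing $\mathcal{H}_1,\mathcal{H}_2$, then $\mathcal{H}_1\sim_P\mathcal{H}_2$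 means that there exists $\varsigma\in S_n$ with $\varsigma(T_1)=T_2$. Graph of $\mathcal{H}$: the vertex- and edge-coloured bipartite graph $\mathcal{G}=(V,E,C_V,C_E)$ where - $V=V_Q\cup V_T$ (disjoint), with qubit nodes $V_Q=\{q_1,\dots,q_n\}$ and term nodes $V_T=\{t_1,\dots,t_m\}$, where $t_r$ corresponds to $(c_r,p_r)$; - there is an edge $(q_i,t_r)$ if and only if $[p_r]_i\neq I$, and there are no other edges; - vertex colours: $C_V(q_i)=\text{``qubit''}$ for all $i$, and $C_V(t_r)=(\text{``term''},c_r)$ for all $r$ (the colour ``qubit'' is different from every term colour); - edge colours: $C_E((q_i,t_r))=[p_r]_i\in\{X,Y,Z\}$. Coloured graphs $\mathcal{G}_1=(V_1,E_1,C_{V_1},C_{E_1})$ and $\mathcal{G}_2=(V_2,E_2,C_{V_2},C_{E_2})$ are isomorphic, written $\mathcal{G}_1\cong\mathcal{G}_2$, if there is a bijection $\phi:V_1\to V_2$ such that $(u,v)\in E_1\iff(\phi(u),\phi(v))\in E_2$, $C_{V_2}(\phi(v))=C_{V_1}(v)$ for all $v\in V_1$, and $C_{E_2}((\phi(u),\phi(v)))=C_{E_1}((u,v))$ for all $(u,v)\in E_1$. *)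

theory Defs
  imports Complex_Main "HOL-Combinatorics.Permutations"
begin

section \<open>Pauli strings and Hamiltonians\<close>

datatype pauli = Pauli_I | Pauli_X | Pauli_Y | Pauli_Z

text \<open>A Pauli string is the list of its single-qubit tensor factors; qubits are numbered from \<open>0\<close>.\<close>

type_synonym pauli_string = "pauli list"

text \<open>\<^const>\<open>permute_list\<close> reads its result at \<open>i\<close> from position \<open>f i\<close>, hence the inverse:
  the operator at qubit \<open>i\<close> has to move to qubit \<open>\<sigma> i\<close>.\<close>

definition permute_string :: "(nat \<Rightarrow> nat) \<Rightarrow> pauli_string \<Rightarrow> pauli_string" where
  "permute_string \<sigma> p = permute_list (inv \<sigma>) p"

lemma length_permute_string [simp]: "length (permute_string \<sigma> p) = length p"
  by (simp add: permute_string_def)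

lemma nth_permute_string:
  assumes "\<sigma> permutes {..<length p}" and "i < length p"
  shows "permute_string \<sigma> p ! \<sigma> i = p ! i"
proof -
  have "inv \<sigma> permutes {..<length p}"
    using assms(1) by (rule permutes_inv)
  moreover have "\<sigma> i < length p"
    using permutes_in_image[OF assms(1), of i] assms(2) by simp
  ultimately show ?thesis
    by (simp add: permute_string_def permute_list_nth permutes_inverses(2)[OF assms(1)])
qed

text \<open>The list \<open>[(c\<^sub>1, p\<^sub>1), \<dots>, (c\<^sub>m, p\<^sub>m)]\<close> stands for the expression
  \<open>c\<^sub>1 p\<^sub>1 + \<dots> + c\<^sub>m p\<^sub>m\<close>.\<close>

type_synonym hamiltonian = "(complex \<times> pauli_string) list"

definition is_hamiltonian :: "nat \<Rightarrow> hamiltonian \<Rightarrow> bool" where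
  "is_hamiltonian n H \<longleftrightarrow>
     distinct (map snd H) \<and> (\<forall>(c, p) \<in> set H. c \<noteq> 0 \<and> length p = n)"

abbreviation term_set :: "hamiltonian \<Rightarrow> (complex \<times> pauli_string) set" where
  "term_set H \<equiv> set H"

definition permute_terms ::
    "(nat \<Rightarrow> nat) \<Rightarrow> (complex \<times> pauli_string) set \<Rightarrow> (complex \<times> pauli_string) set" where
  "permute_terms \<sigma> T = {(c, permute_string \<sigma> p) | c p. (c, p) \<in> T}"

definition perm_equiv :: "nat \<Rightarrow> hamiltonian \<Rightarrow> hamiltonian \<Rightarrow> bool" where
  "perm_equiv n H1 H2 \<longleftrightarrow>
     (\<exists>\<sigma>. \<sigma> permutes {..<n} \<and> permute_terms \<sigma> (term_set H1) = term_set H2)"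


section \<open>Coloured graphs\<close>

text \<open>Only the values of \<open>vcolour\<close> on \<open>verts\<close> and of \<open>ecolour\<close> on \<open>edges\<close> are meaningful.\<close>

record ('v, 'c, 'd) coloured_graph =
  verts :: "'v set"
  edges :: "('v \<times> 'v) set"
  vcolour :: "'v \<Rightarrow> 'c"
  ecolour :: "'v \<times> 'v \<Rightarrow> 'd"

definition coloured_graph_iso ::
    "('v, 'c, 'd) coloured_graph \<Rightarrow> ('w, 'c, 'd) coloured_graph \<Rightarrow> bool" where
  "coloured_graph_iso G1 G2 \<longleftrightarrow>
     (\<exists>\<phi>. bij_betw \<phi> (verts G1) (verts G2) \<and>
          (\<forall>u \<in> verts G1. \<forall>v \<in> verts G1. (u, v) \<in> edges G1 \<longleftrightarrow> (\<phi> u, \<phi> v) \<in> edges G2) \<and>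
          (\<forall>v \<in> verts G1. vcolour G2 (\<phi> v) = vcolour G1 v) \<and>
          (\<forall>(u, v) \<in> edges G1. ecolour G2 (\<phi> u, \<phi> v) = ecolour G1 (u, v)))"


section \<open>The graph of a Hamiltonian\<close>

datatype vertex = Qubit nat | Term nat

datatype vertex_colour = Qubit_Colour | Term_Colour complex

fun hamiltonian_vcolour :: "hamiltonian \<Rightarrow> vertex \<Rightarrow> vertex_colour" where
  "hamiltonian_vcolour H (Qubit i) = Qubit_Colour"
| "hamiltonian_vcolour H (Term r) = Term_Colour (fst (H ! r))"

fun hamiltonian_ecolour :: "hamiltonian \<Rightarrow> vertex \<times> vertex \<Rightarrow> pauli" where
  "hamiltonian_ecolour H (Qubit i, Term r) = snd (H ! r) ! i"
| "hamiltonian_ecolour H _ = undefined"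

text \<open>Edges are written with the qubit node first. Reading the graph as undirected gives the same
  notion of isomorphism, since vertex colours separate qubit nodes from term nodes.\<close>

definition hamiltonian_graph ::
    "nat \<Rightarrow> hamiltonian \<Rightarrow> (vertex, vertex_colour, pauli) coloured_graph" where
  "hamiltonian_graph n H =
     \<lparr> verts = Qubit ` {..<n} \<union> Term ` {..<length H},
       edges = {(Qubit i, Term r) | i r. i < n \<and> r < length H \<and> snd (H ! r) ! i \<noteq> Pauli_I},
       vcolour = hamiltonian_vcolour H,
       ecolour = hamiltonian_ecolour H \<rparr>"

end

theory Submission
  imports Defs
begin

text \<open>Both relations amount to the existence of a qubit permutation \<open>\<sigma>\<close> together with a bijection
  \<open>\<tau>\<close> of term indices that match coefficients and carry the operator at qubit \<open>i\<close> of term \<open>r\<close> to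
  qubit \<open>\<sigma> i\<close> of term \<open>\<tau> r\<close>. Since the Pauli strings are pairwise distinct, a permutation of the
  qubits mapping one term set onto the other determines \<open>\<tau>\<close>; vertex colours split a graph
  isomorphism into \<open>\<sigma>\<close> and \<open>\<tau>\<close>, the operator \<open>I\<close> being encoded by the absence of an edge.\<close>

definition term_matching ::
    "nat \<Rightarrow> hamiltonian \<Rightarrow> hamiltonian \<Rightarrow> (nat \<Rightarrow> nat) \<Rightarrow> (nat \<Rightarrow> nat) \<Rightarrow> bool" where
  "term_matching n H1 H2 \<sigma> \<tau> \<longleftrightarrow>
     \<sigma> permutes {..<n} \<and> bij_betw \<tau> {..<length H1} {..<length H2} \<and>
     (\<forall>r<length H1. fst (H2 ! \<tau> r) = fst (H1 ! r) \<and>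
        (\<forall>i<n. snd (H2 ! \<tau> r) ! \<sigma> i = snd (H1 ! r) ! i))"

lemma is_hamiltonian_length:
  "is_hamiltonian n H \<Longrightarrow> r < length H \<Longrightarrow> length (snd (H ! r)) = n"
  by (simp add: is_hamiltonian_def case_prod_unfold all_set_conv_all_nth)

lemma is_hamiltonian_distinct: "is_hamiltonian n H \<Longrightarrow> distinct H"
  by (simp add: is_hamiltonian_def distinct_map)

text \<open>As \<open>\<sigma>\<close> is onto the positions, checking the positions
  \<open>\<sigma> i\<close> checks all of them. This removes the inverse hidden in
  \<open>permute_string\<close>.\<close>

lemma permute_string_eq_iff:
  assumes "\<sigma> permutes {..<length p}" and "length q = length p"
  shows "permute_string \<sigma> p = q \<longleftrightarrow> (\<forall>i<length p. q ! \<sigma> i = p ! i)"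
proof
  assume "permute_string \<sigma> p = q"
  then show "\<forall>i<length p. q ! \<sigma> i = p ! i"
    using nth_permute_string[OF assms(1)] by auto
next
  assume eq: "\<forall>i<length p. q ! \<sigma> i = p ! i"
  show "permute_string \<sigma> p = q"
  proof (rule nth_equalityI)
    fix j assume "j < length (permute_string \<sigma> p)"
    then have "j \<in> \<sigma> ` {..<length p}"
      by (simp add: permutes_image[OF assms(1)])
    then show "permute_string \<sigma> p ! j = q ! j"
      using nth_permute_string[OF assms(1)] eq by auto
  qed (simp add: assms(2))
qed

lemma inj_on_permute_string:
  assumes "\<sigma> permutes {..<n}"
  shows "inj_on (permute_string \<sigma>) {p. length p = n}"
proof (rule inj_onI)
  fix p q assume "p \<in> {p. length p = n}" "q \<in> {p. length p = n}"
    and eq: "permute_string \<sigma> p = permute_string \<sigma> q"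
  then have len: "length p = n" "length q = n" by auto
  show "p = q"
  proof (rule nth_equalityI)
    fix i assume "i < length p"
    then show "p ! i = q ! i"
      using nth_permute_string[of \<sigma> p i] nth_permute_string[of \<sigma> q i] len assms eq by simp
  qed (simp add: len)
qed

lemma permute_terms_eq_image: "permute_terms \<sigma> T = map_prod id (permute_string \<sigma>) ` T"
  by (force simp: permute_terms_def)

text \<open>Fuses the coefficient and operator conditions into one equation between pairs, the form
  in which term sets are permuted. Agreement at all qubits gives equality of strings because
  well-formedness fixes both lengths to \<open>n\<close>.\<close>

lemma term_matching_altdef:
  assumes "is_hamiltonian n H1" and "is_hamiltonian n H2"
  shows "term_matching n H1 H2 \<sigma> \<tau> \<longleftrightarrow>
     \<sigma> permutes {..<n} \<and> bij_betw \<tau> {..<length H1} {..<length H2} \<and>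
     (\<forall>r<length H1. H2 ! \<tau> r = map_prod id (permute_string \<sigma>) (H1 ! r))"
proof -
  have "(fst (H2 ! \<tau> r) = fst (H1 ! r) \<and> (\<forall>i<n. snd (H2 ! \<tau> r) ! \<sigma> i = snd (H1 ! r) ! i)) \<longleftrightarrow>
      H2 ! \<tau> r = map_prod id (permute_string \<sigma>) (H1 ! r)"
    if "\<sigma> permutes {..<n}" "bij_betw \<tau> {..<length H1} {..<length H2}" "r < length H1" for r
  proof -
    have "\<tau> r < length H2"
      using bij_betwE[OF that(2)] that(3) by auto
    then have "length (snd (H2 ! \<tau> r)) = n" "length (snd (H1 ! r)) = n"
      using assms that(3) is_hamiltonian_length by blast+
    then show ?thesis
      using permute_string_eq_iff[of \<sigma> "snd (H1 ! r)" "snd (H2 ! \<tau> r)"] that(1)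
      by (auto simp: prod_eq_iff)
  qed
  then show ?thesis
    by (auto simp: term_matching_def)
qed

lemma perm_equiv_iff_term_matching:
  assumes "is_hamiltonian n H1" and "is_hamiltonian n H2"
  shows "perm_equiv n H1 H2 \<longleftrightarrow> (\<exists>\<sigma> \<tau>. term_matching n H1 H2 \<sigma> \<tau>)"
proof
  assume "perm_equiv n H1 H2"
  then obtain \<sigma> where \<sigma>: "\<sigma> permutes {..<n}"
    and img: "map_prod id (permute_string \<sigma>) ` set H1 = set H2"
    by (auto simp: perm_equiv_def permute_terms_eq_image)
  let ?f = "map_prod id (permute_string \<sigma>) :: complex \<times> pauli_string \<Rightarrow> _"
  \<comment> \<open>\<open>?\<tau> r\<close> is the index at which the permuted \<open>r\<close>-th
    term of \<open>H1\<close> stands in \<open>H2\<close>.\<close>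
  let ?\<tau> = "inv_into {..<length H2} ((!) H2) \<circ> (?f \<circ> (!) H1)"
  have sub: "set H1 \<subseteq> UNIV \<times> {p. length p = n}"
    using assms(1) by (auto simp: is_hamiltonian_def)
  have "inj_on ?f (UNIV \<times> {p. length p = n})"
    by (intro map_prod_inj_on inj_on_permute_string \<sigma>) simp
  then have f: "bij_betw ?f (set H1) (set H2)"
    using img sub by (auto simp: bij_betw_def intro: inj_on_subset)
  \<comment> \<open>Distinctness of the terms makes indices and terms interchangeable, so
    \<open>?\<tau>\<close> is a composition of three bijections.\<close>
  have H1: "bij_betw ((!) H1) {..<length H1} (set H1)"
    and H2: "bij_betw ((!) H2) {..<length H2} (set H2)"
    using assms by (auto intro: bij_betw_nth is_hamiltonian_distinct)
  have \<tau>: "bij_betw ?\<tau> {..<length H1} {..<length H2}"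
    using bij_betw_trans[OF bij_betw_trans[OF H1 f] bij_betw_inv_into[OF H2]] .
  have "H2 ! ?\<tau> r = ?f (H1 ! r)" if "r < length H1" for r
  proof -
    have "?f (H1 ! r) \<in> set H2"
      using img that nth_mem by blast
    then show ?thesis
      using bij_betw_inv_into_right[OF H2] by simp
  qed
  then show "\<exists>\<sigma> \<tau>. term_matching n H1 H2 \<sigma> \<tau>"
    using \<sigma> \<tau> term_matching_altdef[OF assms] by blast
next
  assume "\<exists>\<sigma> \<tau>. term_matching n H1 H2 \<sigma> \<tau>"
  then obtain \<sigma> \<tau> where \<sigma>: "\<sigma> permutes {..<n}"
    and \<tau>: "\<tau> ` {..<length H1} = {..<length H2}"
    and eq: "\<And>r. r < length H1 \<Longrightarrow> H2 ! \<tau> r = map_prod id (permute_string \<sigma>) (H1 ! r)"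
    using term_matching_altdef[OF assms] by (auto simp: bij_betw_def)
  have nth: "set H = (!) H ` {..<length H}" for H :: hamiltonian
    by (auto simp: set_conv_nth)
  \<comment> \<open>Term sets are images of index ranges; since \<open>\<tau>\<close> is onto the
    indices of \<open>H2\<close>, the permuted terms exhaust \<open>H2\<close>.\<close>
  have "map_prod id (permute_string \<sigma>) ` set H1 = (\<lambda>r. H2 ! \<tau> r) ` {..<length H1}"
    unfolding nth[of H1] image_image by (rule image_cong) (simp_all add: eq)
  also have "\<dots> = set H2"
    by (simp add: nth[of H2] \<tau>[symmetric] image_image)
  finally show "perm_equiv n H1 H2"
    using \<sigma> by (auto simp: perm_equiv_def permute_terms_eq_image)
qed

text \<open>The preimage of a vertex has the same colour as the vertex, so the restriction to a
  colour class stays onto. Used to separate qubit nodes from term nodes.\<close>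

lemma bij_betw_colour_class:
  assumes "bij_betw \<phi> V W" and "\<And>v. v \<in> V \<Longrightarrow> d (\<phi> v) = c v"
  shows "bij_betw \<phi> {v \<in> V. P (c v)} {w \<in> W. P (d w)}"
  using assms unfolding bij_betw_def by (auto intro: inj_on_subset)

text \<open>Strips a constructor \<open>f\<close> from a bijection between tagged sets, leaving one
  between the underlying indices.\<close>

lemma bij_betw_conjugate_inj:
  assumes "inj f" and "bij_betw \<phi> (f ` A) (f ` B)"
  shows "bij_betw (inv f \<circ> \<phi> \<circ> f) A B" and "a \<in> A \<Longrightarrow> \<phi> (f a) = f ((inv f \<circ> \<phi> \<circ> f) a)"
proof -
  have "bij_betw f A (f ` A)" "bij_betw (inv f) (f ` B) B"
    using assms(1) by (auto simp: bij_betw_def inj_on_def image_image)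
  then show "bij_betw (inv f \<circ> \<phi> \<circ> f) A B"
    using assms(2) by (metis bij_betw_trans comp_assoc)
  show "\<phi> (f a) = f ((inv f \<circ> \<phi> \<circ> f) a)" if "a \<in> A"
    using bij_betwE[OF assms(2)] that assms(1) by force
qed

lemma bij_betw_image_intertwine:
  assumes "inj f" and "bij_betw \<sigma> A B" and "\<And>a. \<phi> (f a) = f (\<sigma> a)"
  shows "bij_betw \<phi> (f ` A) (f ` B)"
proof -
  have "\<phi> ` f ` A = f ` \<sigma> ` A"
    by (simp add: image_image assms(3))
  moreover have "inj_on \<phi> (f ` A)"
    using assms(2) by (auto simp: bij_betw_def assms(3) inj_eq[OF assms(1)] intro!: inj_onI dest: inj_onD)
  ultimately show ?thesis
    using assms(2) by (simp add: bij_betw_def)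
qed

text \<open>Reading a missing edge as \<open>Pauli_I\<close>, the graph is a matrix of operators
  with qubits as rows and terms as columns. Vertex colours keep rows and columns apart, so an
  isomorphism is a row permutation \<open>\<sigma>\<close> with a column bijection
  \<open>\<tau>\<close>.\<close>

lemma coloured_graph_iso_iff_term_matching:
  "coloured_graph_iso (hamiltonian_graph n H1) (hamiltonian_graph n H2) \<longleftrightarrow>
     (\<exists>\<sigma> \<tau>. term_matching n H1 H2 \<sigma> \<tau>)"
proof
  let ?V = "\<lambda>H :: hamiltonian. Qubit ` {..<n} \<union> Term ` {..<length H}"
  assume "coloured_graph_iso (hamiltonian_graph n H1) (hamiltonian_graph n H2)"
  then obtain \<phi> where bij: "bij_betw \<phi> (?V H1) (?V H2)"
    and edge: "\<And>u v. u \<in> ?V H1 \<Longrightarrow> v \<in> ?V H1 \<Longrightarrow>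
      (u, v) \<in> edges (hamiltonian_graph n H1) \<longleftrightarrow> (\<phi> u, \<phi> v) \<in> edges (hamiltonian_graph n H2)"
    and vcol: "\<And>v. v \<in> ?V H1 \<Longrightarrow> hamiltonian_vcolour H2 (\<phi> v) = hamiltonian_vcolour H1 v"
    and ecol: "\<And>u v. (u, v) \<in> edges (hamiltonian_graph n H1) \<Longrightarrow>
      hamiltonian_ecolour H2 (\<phi> u, \<phi> v) = hamiltonian_ecolour H1 (u, v)"
    unfolding coloured_graph_iso_def by (auto simp: hamiltonian_graph_def)
  have inj_Qubit: "inj Qubit" and inj_Term: "inj Term"
    by (simp_all add: inj_def)
  have "{v \<in> ?V H. hamiltonian_vcolour H v = Qubit_Colour} = Qubit ` {..<n}" for H
    by auto
  then have "bij_betw \<phi> (Qubit ` {..<n}) (Qubit ` {..<n})"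
    using bij_betw_colour_class[where d = "hamiltonian_vcolour H2" and c = "hamiltonian_vcolour H1"
        and P = "\<lambda>c. c = Qubit_Colour", OF bij vcol] by simp
  note Q = bij_betw_conjugate_inj[OF inj_Qubit this]
  have "{v \<in> ?V H. hamiltonian_vcolour H v \<noteq> Qubit_Colour} = Term ` {..<length H}" for H
    by auto
  then have "bij_betw \<phi> (Term ` {..<length H1}) (Term ` {..<length H2})"
    using bij_betw_colour_class[where d = "hamiltonian_vcolour H2" and c = "hamiltonian_vcolour H1"
        and P = "\<lambda>c. c \<noteq> Qubit_Colour", OF bij vcol] by simp
  note T = bij_betw_conjugate_inj[OF inj_Term this]
  \<comment> \<open>Beyond \<open>n\<close> nothing is known of \<open>\<phi>\<close>, whereas
    \<open>permutes\<close> demands fixed points there; hence the identity.\<close>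
  define \<sigma> where "\<sigma> = (\<lambda>i. if i < n then (inv Qubit \<circ> \<phi> \<circ> Qubit) i else i)"
  define \<tau> where "\<tau> = inv Term \<circ> \<phi> \<circ> Term"
  have "bij_betw \<sigma> {..<n} {..<n}"
    using Q(1) by (rule bij_betw_cong[THEN iffD1, rotated]) (simp add: \<sigma>_def)
  then have \<sigma>: "\<sigma> permutes {..<n}"
    by (rule bij_imp_permutes) (simp add: \<sigma>_def)
  have \<tau>: "bij_betw \<tau> {..<length H1} {..<length H2}"
    using T(1) by (simp add: \<tau>_def)
  have \<phi>Q: "\<phi> (Qubit i) = Qubit (\<sigma> i)" if "i < n" for i
    using Q(2)[of i] that by (simp add: \<sigma>_def)
  have \<phi>T: "\<phi> (Term r) = Term (\<tau> r)" if "r < length H1" for r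
    using T(2)[of r] that by (simp add: \<tau>_def)
  have "fst (H2 ! \<tau> r) = fst (H1 ! r)" if "r < length H1" for r
    using vcol[of "Term r"] that by (simp add: \<phi>T)
  moreover have "snd (H2 ! \<tau> r) ! \<sigma> i = snd (H1 ! r) ! i" if "r < length H1" "i < n" for r i
  proof -
    \<comment> \<open>Only within these bounds does the absence of an edge in the second graph mean
      \<open>Pauli_I\<close>. Preservation of edges then settles the operator
      \<open>Pauli_I\<close>, and edge colours settle the other three.\<close>
    have "\<sigma> i < n"
      using permutes_in_image[OF \<sigma>, of i] that(2) by simp
    moreover have "\<tau> r < length H2"
      using bij_betwE[OF \<tau>] that(1) by auto
    ultimately show ?thesis
      using edge[of "Qubit i" "Term r"] ecol[of "Qubit i" "Term r"] that
      by (cases "snd (H1 ! r) ! i = Pauli_I") (auto simp: \<phi>Q \<phi>T hamiltonian_graph_def)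
  qed
  ultimately show "\<exists>\<sigma> \<tau>. term_matching n H1 H2 \<sigma> \<tau>"
    using \<sigma> \<tau> unfolding term_matching_def by blast
next
  assume "\<exists>\<sigma> \<tau>. term_matching n H1 H2 \<sigma> \<tau>"
  then obtain \<sigma> \<tau> where \<sigma>: "\<sigma> permutes {..<n}"
    and \<tau>: "bij_betw \<tau> {..<length H1} {..<length H2}"
    and coeff: "\<And>r. r < length H1 \<Longrightarrow> fst (H2 ! \<tau> r) = fst (H1 ! r)"
    and op: "\<And>r i. r < length H1 \<Longrightarrow> i < n \<Longrightarrow> snd (H2 ! \<tau> r) ! \<sigma> i = snd (H1 ! r) ! i"
    by (auto simp: term_matching_def)
  have \<sigma>_less: "\<sigma> i < n \<longleftrightarrow> i < n" for i
    using permutes_in_image[OF \<sigma>, of i] by simp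
  have \<tau>_less: "\<tau> r < length H2" if "r < length H1" for r
    using bij_betwE[OF \<tau>] that by auto
  define \<phi> where "\<phi> = case_vertex (\<lambda>i. Qubit (\<sigma> i)) (\<lambda>r. Term (\<tau> r))"
  have "bij_betw \<phi> (Qubit ` {..<n}) (Qubit ` {..<n})"
    using permutes_imp_bij[OF \<sigma>]
    by (rule bij_betw_image_intertwine[rotated]) (simp_all add: \<phi>_def inj_def)
  moreover have "bij_betw \<phi> (Term ` {..<length H1}) (Term ` {..<length H2})"
    using \<tau>
    by (rule bij_betw_image_intertwine[rotated]) (simp_all add: \<phi>_def inj_def)
  ultimately have bij: "bij_betw \<phi> (Qubit ` {..<n} \<union> Term ` {..<length H1})
      (Qubit ` {..<n} \<union> Term ` {..<length H2})"
    by (rule bij_betw_combine) auto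
  \<comment> \<open>\<open>op\<close> preserves both the edges, as non-identity entries, and their
    colours; \<open>coeff\<close> preserves the colours of term nodes.\<close>
  show "coloured_graph_iso (hamiltonian_graph n H1) (hamiltonian_graph n H2)"
    unfolding coloured_graph_iso_def
    by (rule exI[of _ \<phi>])
      (use bij in \<open>auto simp: hamiltonian_graph_def \<phi>_def \<sigma>_less \<tau>_less coeff op\<close>)
qed

theorem proposition2:
  fixes n :: nat and H1 H2 :: hamiltonian
  assumes "is_hamiltonian n H1" and "is_hamiltonian n H2"
  shows "perm_equiv n H1 H2 \<longleftrightarrow>
           coloured_graph_iso (hamiltonian_graph n H1) (hamiltonian_graph n H2)"
  using perm_equiv_iff_term_matching[OF assms] coloured_graph_iso_iff_term_matching by simp

end
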